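(* Let $X$ be a semigroup. The following conditions are equivalent: (1) $X$ is $E$-separated; (2) $X$ is $E$-viable; (3) $X$ is $E_{\Uparrow}$-central; (4) $X$ is $E$-hypercentral; (5) $X$ is viable. Moreover, the equivalent conditions (1)–(5) imply the condition (6) $X$ is $E$-hypocentral and $E$-upcentral.
   Context: Let $X$ be a semigroup and $E(X)=\{x\in X: xx=x\}$ its set of idempotents. A semilattice is a commutative semigroup all of whose elements are idempotents. $X^1=X\cup\{1\}$, where $1$ is an element with $1x=x=x1$ for all $x\in X^1$. For $a\in X$, the $\mathcal H$-class of $a$ is $H_a=\{x\in X: xX^1=aX^1 \text{ and } X^1x=X^1a\}$; for $e\in E(X)$ it is the maximal subgroup of $X$ containing $e$. For $A\subseteq X$, $\sqrt[\infty]{A}=\{x\in X: x^n\in A\text{ for some } n\geq 1\}$. Let $\mathbf 2=\{0,1\}$ with the usual multiplication and the order $0\le 1$. For $x,y\in X$ write $x\lesssim y$ if $\chi(x)\le\chi(y)$ for every semigroup homomorphism $\chi:X\to\mathbf 2$. Put ${\Uparrow}a=\{x\in X: a\lesssim x\}$. An ideal in $X$ is a subset $I\subseteq X$ with $IX\cup XI\subseteq I$ (the sets $\emptyset$ and $X$ are ideals). A coideal in $X$ is a subset whose complement in $X$ is an ideal. For $e\in E(X)$ put $\frac{H_e}{e}=\{x\in X: xe=ex\in H_e\}$ (a subsemigroup of $X$). An idempotent $e$ of $X$ is called viable if $\frac{H_e}{e}$ is a coideal in $X$. The semigroup $X$ is called: - $E$-separated if for any distinct $x,y\in E(X)$ there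 is a homomorphism $h:X\to Y$ to a semilattice $Y$ with $h(x)\neq h(y)$; - viable if for all $x,y\in X$ with $\{xy,yx\}\subseteq E(X)$ we have $xy=yx$; - $E$-viable if every idempotent of $X$ is viable; - $E_{\Uparrow}$-central if for any $e\in E(X)$ and $x\in{\Uparrow}e$ we have $ex=xe$; - $E$-hypercentral if for any $e\in E(X)$ and $x,y\in X$ with $xy=e$ we have $xe=ex$ and $ye=ey$; - $E$-hypocentral if for any $e\in E(X)$ and $x,y\in X$ with $xy=e$ we have $xe=ex$ or $ye=ey$; - $E$-upcentral if for any $e,f\in E(X)$ with $fe=e=ef$ and any $x\in\sqrt[\infty]{H_f}$ we have $xe=ex$. *)

theory Defs
  imports Main
begin

text \<open>
  A semigroup is a type with an operation satisfying the library locale \<open>semigroup\<close>, and a semilattice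
  is one satisfying \<open>semilattice\<close> (associative, commutative, idempotent).
\<close>

definition semigroup_hom :: "('a \<Rightarrow> 'a \<Rightarrow> 'a) \<Rightarrow> ('b \<Rightarrow> 'b \<Rightarrow> 'b) \<Rightarrow> ('a \<Rightarrow> 'b) \<Rightarrow> bool" where
  "semigroup_hom f g h \<longleftrightarrow> (\<forall>x y. h (f x y) = g (h x) (h y))"

context semigroup
begin

definition idempotents :: "'a set" where
  "idempotents = {x. x \<^bold>* x = x}"

text \<open>\<open>aX\<^sup>1\<close> and \<open>X\<^sup>1a\<close>: the adjoined unit contributes the element \<open>a\<close> itself.\<close>

definition right_principal :: "'a \<Rightarrow> 'a set" where
  "right_principal a = {a} \<union> {a \<^bold>* y | y. True}"

definition left_principal :: "'a \<Rightarrow> 'a set" where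
  "left_principal a = {a} \<union> {y \<^bold>* a | y. True}"

definition H_class :: "'a \<Rightarrow> 'a set" where
  "H_class a = {x. right_principal x = right_principal a \<and> left_principal x = left_principal a}"

text \<open>For \<open>n \<ge> 1\<close> this is \<open>x\<^sup>n\<close>; there is no unit, so exponent \<open>0\<close> has no meaning and is never used.\<close>

definition pow :: "'a \<Rightarrow> nat \<Rightarrow> 'a" where
  "pow x n = (((\<^bold>*) x) ^^ (n - 1)) x"

definition root_infinity :: "'a set \<Rightarrow> 'a set" where
  "root_infinity A = {x. \<exists>n\<ge>1. pow x n \<in> A}"

text \<open>The two-element semilattice \<open>{0, 1}\<close> is taken inside the natural numbers with their multiplication and order.\<close>

definition character :: "('a \<Rightarrow> nat) \<Rightarrow> bool" where
  "character \<chi> \<longleftrightarrow> range \<chi> \<subseteq> {0, 1} \<and> semigroup_hom (\<^bold>*) (*) \<chi>"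

definition lesssim :: "'a \<Rightarrow> 'a \<Rightarrow> bool" where
  "lesssim x y \<longleftrightarrow> (\<forall>\<chi>. character \<chi> \<longrightarrow> \<chi> x \<le> \<chi> y)"

definition Up :: "'a \<Rightarrow> 'a set" where
  "Up a = {x. lesssim a x}"

definition ideal :: "'a set \<Rightarrow> bool" where
  "ideal I \<longleftrightarrow> (\<forall>i\<in>I. \<forall>x. i \<^bold>* x \<in> I \<and> x \<^bold>* i \<in> I)"

definition coideal :: "'a set \<Rightarrow> bool" where
  "coideal C \<longleftrightarrow> ideal (- C)"

text \<open>The set \<open>H\<^sub>e/e\<close>.\<close>

definition H_quotient :: "'a \<Rightarrow> 'a set" where
  "H_quotient e = {x. x \<^bold>* e = e \<^bold>* x \<and> e \<^bold>* x \<in> H_class e}"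

definition viable_idempotent :: "'a \<Rightarrow> bool" where
  "viable_idempotent e \<longleftrightarrow> e \<in> idempotents \<and> coideal (H_quotient e)"

text \<open>
  HOL cannot quantify over the type of the semilattice \<open>Y\<close> inside a formula, so \<open>Y\<close> ranges over all
  semilattice structures on \<^typ>\<open>'a set\<close>. This loses nothing: by \<open>E_separatedI\<close> below, separating
  homomorphisms into semilattices of arbitrary types are enough for \<open>E_separated\<close>.
\<close>

definition E_separated :: bool where
  "E_separated \<longleftrightarrow> (\<forall>x\<in>idempotents. \<forall>y\<in>idempotents. x \<noteq> y \<longrightarrow>
     (\<exists>(g :: 'a set \<Rightarrow> 'a set \<Rightarrow> 'a set) h. semilattice g \<and> semigroup_hom (\<^bold>*) g h \<and> h x \<noteq> h y))"

lemma semilattice_hom_into_sets: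
  fixes g :: "'b \<Rightarrow> 'b \<Rightarrow> 'b"
  assumes "semilattice g" "semigroup_hom (\<^bold>*) g h" "h x \<noteq> h y"
  shows "\<exists>(g' :: 'a set \<Rightarrow> 'a set \<Rightarrow> 'a set) h'.
    semilattice g' \<and> semigroup_hom (\<^bold>*) g' h' \<and> h' x \<noteq> h' y"
proof -
  interpret Y: semilattice g by fact
  define k where "k u = {v. g (h v) (h u) = h v}" for u
  have le: "g c (g a b) = c \<longleftrightarrow> g c a = c \<and> g c b = c" for a b c
  proof
    assume *: "g c (g a b) = c"
    have "g (g c (g a b)) a = g c (g a b)"
      by (simp add: Y.assoc Y.commute Y.left_commute)
    moreover have "g (g c (g a b)) b = g c (g a b)"
      by (simp add: Y.assoc Y.commute Y.left_commute)
    ultimately show "g c a = c \<and> g c b = c"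
      unfolding * by (rule conjI)
  next
    assume "g c a = c \<and> g c b = c"
    then have "g (g c a) b = c" by simp
    then show "g c (g a b) = c" by (simp only: Y.assoc)
  qed
  have hom: "h (u \<^bold>* v) = g (h u) (h v)" for u v
    using assms(2) unfolding semigroup_hom_def by blast
  have "k (u \<^bold>* v) = k u \<inter> k v" for u v
    unfolding k_def hom le by (rule Collect_conj_eq)
  then have "semigroup_hom (\<^bold>*) (\<inter>) k"
    unfolding semigroup_hom_def by blast
  moreover have "k x \<noteq> k y"
  proof
    assume eq: "k x = k y"
    have "x \<in> k x" "y \<in> k y" by (simp_all add: k_def)
    then have "x \<in> k y" "y \<in> k x" by (simp_all only: eq)
    then have xy: "g (h x) (h y) = h x" and yx: "g (h y) (h x) = h y" by (simp_all only: k_def mem_Collect_eq)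
    have "h x = h y" by (rule trans[OF sym[OF xy] trans[OF Y.commute yx]])
    then show False using assms(3) by contradiction
  qed
  moreover have "semilattice ((\<inter>) :: 'a set \<Rightarrow> 'a set \<Rightarrow> 'a set)"
    by standard auto
  ultimately show ?thesis by (intro exI conjI)
qed

lemma E_separatedI:
  assumes "\<And>x y. x \<in> idempotents \<Longrightarrow> y \<in> idempotents \<Longrightarrow> x \<noteq> y \<Longrightarrow>
    \<exists>(g :: 'b \<Rightarrow> 'b \<Rightarrow> 'b) h. semilattice g \<and> semigroup_hom (\<^bold>*) g h \<and> h x \<noteq> h y"
  shows E_separated
  unfolding E_separated_def
proof (intro ballI impI)
  fix x y
  assume "x \<in> idempotents" "y \<in> idempotents" "x \<noteq> y"
  from assms[OF this] obtain g :: "'b \<Rightarrow> 'b \<Rightarrow> 'b" and h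
    where gh: "semilattice g" "semigroup_hom (\<^bold>*) g h" "h x \<noteq> h y"
    by (elim exE conjE)
  show "\<exists>(g :: 'a set \<Rightarrow> 'a set \<Rightarrow> 'a set) h.
      semilattice g \<and> semigroup_hom (\<^bold>*) g h \<and> h x \<noteq> h y"
    by (rule semilattice_hom_into_sets[OF gh])
qed

definition viable :: bool where
  "viable \<longleftrightarrow> (\<forall>x y. {x \<^bold>* y, y \<^bold>* x} \<subseteq> idempotents \<longrightarrow> x \<^bold>* y = y \<^bold>* x)"

definition E_viable :: bool where
  "E_viable \<longleftrightarrow> (\<forall>e\<in>idempotents. viable_idempotent e)"

definition E_Up_central :: bool where
  "E_Up_central \<longleftrightarrow> (\<forall>e\<in>idempotents. \<forall>x\<in>Up e. e \<^bold>* x = x \<^bold>* e)"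

definition E_hypercentral :: bool where
  "E_hypercentral \<longleftrightarrow> (\<forall>e\<in>idempotents. \<forall>x y. x \<^bold>* y = e \<longrightarrow>
     x \<^bold>* e = e \<^bold>* x \<and> y \<^bold>* e = e \<^bold>* y)"

definition E_hypocentral :: bool where
  "E_hypocentral \<longleftrightarrow> (\<forall>e\<in>idempotents. \<forall>x y. x \<^bold>* y = e \<longrightarrow>
     x \<^bold>* e = e \<^bold>* x \<or> y \<^bold>* e = e \<^bold>* y)"

definition E_upcentral :: bool where
  "E_upcentral \<longleftrightarrow> (\<forall>e\<in>idempotents. \<forall>f\<in>idempotents. f \<^bold>* e = e \<and> e = e \<^bold>* f \<longrightarrow>
     (\<forall>x\<in>root_infinity (H_class f). x \<^bold>* e = e \<^bold>* x))"

end

end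

theory Submission imports Defs begin

text \<open>
  The heart of the matter is an observation about a factorization \<open>x \<^bold>* y = e\<close> of an idempotent.
  The elements \<open>e \<^bold>* x\<close> and \<open>y \<^bold>* e\<close> still multiply to \<open>e\<close>, and their product in the other order,
  \<open>y \<^bold>* e \<^bold>* x\<close>, is automatically idempotent. Viability therefore forces \<open>y \<^bold>* e \<^bold>* x = e\<close>, and this
  single equation makes \<open>x\<close> and \<open>y\<close> commute with \<open>e\<close> and makes \<open>e \<^bold>* x\<close>, \<open>e \<^bold>* y\<close> mutually inverse
  elements of the group \<open>H_class e\<close> (\<open>viable_factors_in_H_quotient\<close>). Since an inverse
  in \<open>H_class e\<close> turns the factors of any element of \<open>H_quotient e\<close> into factors of \<open>e\<close>, it
  follows that \<open>H_quotient e\<close> is a coideal, which is viability of \<open>e\<close>.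

  Conversely, \<open>H_quotient e\<close> is always a subsemigroup, so when it is a coideal its indicator function
  is a homomorphism to the two-element semilattice (\<open>mult_in_H_quotient_iff\<close>). These homomorphisms
  separate idempotents, because \<open>e\<close> is the only idempotent of \<open>H_class e\<close>; and they show that every
  \<open>x\<close> in \<open>Up e\<close> lies in \<open>H_quotient e\<close> and hence commutes with \<open>e\<close>. As the factors of \<open>e\<close> lie in
  \<open>Up e\<close>, this centrality gives hypercentrality.

  The way back to viability is short from both ends. A homomorphism to a semilattice cannot
  distinguish \<open>x \<^bold>* y\<close> from \<open>y \<^bold>* x\<close>; and in a hypercentral semigroup both of these idempotents can
  be moved past \<open>y\<close>, after which each is seen to equal the product of the two. Finally, upcentrality is
  an instance of hypercentrality: an element with a power in \<open>H_class d\<close> is a left factor of every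
  idempotent below \<open>d\<close>.
\<close>

context semigroup
begin

text \<open>Right-associated products hide the left-hand side of an equation \<open>a \<^bold>* b = c\<close>; this form
  makes the equation usable as a rewrite rule inside longer words.\<close>

lemma mult_eq_extend: "a \<^bold>* b = c \<Longrightarrow> a \<^bold>* (b \<^bold>* z) = c \<^bold>* z"
  by (simp add: assoc[symmetric])

text \<open>
  This is the description of \<open>H_class e\<close> as the group of units of the monoid of all \<open>z\<close> with
  \<open>e \<^bold>* z = z = z \<^bold>* e\<close>. The definition provides a right inverse \<open>u\<close> and a left inverse \<open>v\<close> of
  \<open>x\<close>; then \<open>e \<^bold>* u = v \<^bold>* x \<^bold>* u = v \<^bold>* e\<close> is a two-sided inverse inside this monoid.
\<close>

lemma H_class_idempotent_iff:
  assumes "e \<in> idempotents"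
  shows "x \<in> H_class e \<longleftrightarrow>
    e \<^bold>* x = x \<and> x \<^bold>* e = x \<and> (\<exists>y. e \<^bold>* y = y \<and> y \<^bold>* e = y \<and> x \<^bold>* y = e \<and> y \<^bold>* x = e)"
proof
  have ee: "e \<^bold>* e = e" using assms by (simp add: idempotents_def)
  {
    assume "x \<in> H_class e"
    then have R: "right_principal x = right_principal e" and L: "left_principal x = left_principal e"
      by (auto simp: H_class_def)
    have "x \<in> right_principal e" using R by (auto simp: right_principal_def)
    then have ex: "e \<^bold>* x = x" by (auto simp: right_principal_def ee assoc[symmetric])
    have "x \<in> left_principal e" using L by (auto simp: left_principal_def)
    then have xe: "x \<^bold>* e = x" by (auto simp: left_principal_def ee assoc)
    have "e \<in> right_principal x" using R by (auto simp: right_principal_def)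
    then obtain u where u: "x \<^bold>* u = e" using ee by (auto simp: right_principal_def)
    have "e \<in> left_principal x" using L by (auto simp: left_principal_def)
    then obtain v where v: "v \<^bold>* x = e" using ee by (auto simp: left_principal_def)
    have "e \<^bold>* u = v \<^bold>* x \<^bold>* u" by (simp add: v)
    also have "\<dots> = v \<^bold>* e" by (simp add: u assoc)
    finally have uv: "e \<^bold>* u = v \<^bold>* e" .
    let ?y = "e \<^bold>* u"
    have "e \<^bold>* ?y = ?y" by (simp add: ee assoc[symmetric])
    moreover have "?y \<^bold>* e = ?y" by (simp add: uv ee assoc)
    moreover have "x \<^bold>* ?y = e" by (simp add: xe u assoc[symmetric])
    moreover have "?y \<^bold>* x = e" by (simp add: uv ex v assoc)
    ultimately show "e \<^bold>* x = x \<and> x \<^bold>* e = x \<and>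
        (\<exists>y. e \<^bold>* y = y \<and> y \<^bold>* e = y \<and> x \<^bold>* y = e \<and> y \<^bold>* x = e)"
      using ex xe by blast
  }
  assume "e \<^bold>* x = x \<and> x \<^bold>* e = x \<and> (\<exists>y. e \<^bold>* y = y \<and> y \<^bold>* e = y \<and> x \<^bold>* y = e \<and> y \<^bold>* x = e)"
  then obtain y where ex: "e \<^bold>* x = x" and xe: "x \<^bold>* e = x" and xy: "x \<^bold>* y = e" and yx: "y \<^bold>* x = e"
    by blast
  have "right_principal x = right_principal e"
  proof (intro set_eqI iffI)
    fix z
    show "z \<in> right_principal e" if "z \<in> right_principal x"
      using that mult_eq_extend[OF ex] ex by (auto simp: right_principal_def) metis+
    show "z \<in> right_principal x" if "z \<in> right_principal e"
      using that mult_eq_extend[OF xy] xy by (auto simp: right_principal_def) metis+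
  qed
  moreover have "left_principal x = left_principal e"
  proof (intro set_eqI iffI)
    fix z
    show "z \<in> left_principal e" if "z \<in> left_principal x"
      using that xe assoc[of _ x e] by (auto simp: left_principal_def) metis+
    show "z \<in> left_principal x" if "z \<in> left_principal e"
      using that yx assoc[of _ y x] by (auto simp: left_principal_def) metis+
  qed
  ultimately show "x \<in> H_class e" by (simp add: H_class_def)
qed

lemma self_in_H_class: "e \<in> H_class e"
  by (simp add: H_class_def)

lemma idempotent_in_H_class_unique:
  assumes "e \<in> idempotents" "d \<in> idempotents" "d \<in> H_class e"
  shows "d = e"
proof -
  obtain y where de: "d \<^bold>* e = d" and dy: "d \<^bold>* y = e"
    using assms(3) unfolding H_class_idempotent_iff[OF assms(1)] by blast
  have "d \<^bold>* (d \<^bold>* y) = d \<^bold>* y"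
    using assms(2) by (simp add: idempotents_def assoc[symmetric])
  then show ?thesis using de dy by simp
qed

lemma H_class_mult_closed:
  assumes e: "e \<in> idempotents" and "a \<in> H_class e" "b \<in> H_class e"
  shows "a \<^bold>* b \<in> H_class e"
proof -
  obtain a' where a: "e \<^bold>* a = a" "a \<^bold>* e = a" "e \<^bold>* a' = a'" "a' \<^bold>* e = a'" "a \<^bold>* a' = e" "a' \<^bold>* a = e"
    using assms(2) unfolding H_class_idempotent_iff[OF e] by blast
  obtain b' where b: "e \<^bold>* b = b" "b \<^bold>* e = b" "e \<^bold>* b' = b'" "b' \<^bold>* e = b'" "b \<^bold>* b' = e" "b' \<^bold>* b = e"
    using assms(3) unfolding H_class_idempotent_iff[OF e] by blast
  have "e \<^bold>* (a \<^bold>* b) = a \<^bold>* b" "a \<^bold>* b \<^bold>* e = a \<^bold>* b"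
    "e \<^bold>* (b' \<^bold>* a') = b' \<^bold>* a'" "b' \<^bold>* a' \<^bold>* e = b' \<^bold>* a'"
    "a \<^bold>* b \<^bold>* (b' \<^bold>* a') = e" "b' \<^bold>* a' \<^bold>* (a \<^bold>* b) = e"
    by (simp_all add: assoc a b a[THEN mult_eq_extend] b[THEN mult_eq_extend])
  then show ?thesis unfolding H_class_idempotent_iff[OF e] by blast
qed

lemma H_quotient_mult_closed:
  assumes e: "e \<in> idempotents" and x: "x \<in> H_quotient e" and y: "y \<in> H_quotient e"
  shows "x \<^bold>* y \<in> H_quotient e"
proof -
  have xe: "x \<^bold>* e = e \<^bold>* x" and ye: "y \<^bold>* e = e \<^bold>* y"
    and H: "e \<^bold>* x \<in> H_class e" "e \<^bold>* y \<in> H_class e"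
    using x y by (auto simp: H_quotient_def)
  have ee: "e \<^bold>* e = e" using e by (simp add: idempotents_def)
  have "x \<^bold>* y \<^bold>* e = e \<^bold>* (x \<^bold>* y)"
    by (simp add: assoc xe ye xe[THEN mult_eq_extend] ye[THEN mult_eq_extend])
  moreover have "e \<^bold>* x \<^bold>* (e \<^bold>* y) = e \<^bold>* (x \<^bold>* y)"
    by (simp add: assoc xe ee xe[THEN mult_eq_extend] ee[THEN mult_eq_extend])
  ultimately show ?thesis
    using H_class_mult_closed[OF e H] by (simp add: H_quotient_def)
qed

text \<open>Together with closure under products, the coideal property makes the indicator function of
  \<open>H_quotient e\<close> multiplicative.\<close>

lemma mult_in_H_quotient_iff:
  assumes "viable_idempotent e"
  shows "x \<^bold>* y \<in> H_quotient e \<longleftrightarrow> x \<in> H_quotient e \<and> y \<in> H_quotient e"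
  using assms H_quotient_mult_closed
  unfolding viable_idempotent_def coideal_def ideal_def by blast

text \<open>
  Viability is applied to the pair \<open>e \<^bold>* x\<close>, \<open>y \<^bold>* e\<close> rather than to \<open>x\<close>, \<open>y\<close>: the product
  \<open>y \<^bold>* x\<close> need not be idempotent, but \<open>y \<^bold>* e \<^bold>* x\<close> is.
\<close>

lemma viable_factors_in_H_quotient:
  assumes viable and e: "e \<in> idempotents" and xy: "x \<^bold>* y = e"
  shows "x \<in> H_quotient e" "y \<in> H_quotient e"
proof -
  have ee: "e \<^bold>* e = e" using e by (simp add: idempotents_def)
  have 1: "e \<^bold>* x \<^bold>* (y \<^bold>* e) = e"
    by (simp add: assoc xy ee xy[THEN mult_eq_extend] ee[THEN mult_eq_extend])
  have 2: "y \<^bold>* e \<^bold>* (e \<^bold>* x) = y \<^bold>* e \<^bold>* x"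
    by (simp add: assoc ee ee[THEN mult_eq_extend])
  have "y \<^bold>* e \<^bold>* x \<^bold>* (y \<^bold>* e \<^bold>* x) = y \<^bold>* e \<^bold>* x"
    by (simp add: assoc xy ee xy[THEN mult_eq_extend] ee[THEN mult_eq_extend])
  then have "{e \<^bold>* x \<^bold>* (y \<^bold>* e), y \<^bold>* e \<^bold>* (e \<^bold>* x)} \<subseteq> idempotents"
    using ee unfolding 1 2 by (simp add: idempotents_def)
  then have "e \<^bold>* x \<^bold>* (y \<^bold>* e) = y \<^bold>* e \<^bold>* (e \<^bold>* x)"
    using \<open>viable\<close> unfolding viable_def by blast
  then have yex: "y \<^bold>* e \<^bold>* x = e" unfolding 1 2 by simp
  have "x \<^bold>* (y \<^bold>* e \<^bold>* x) = e \<^bold>* x"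
    by (simp add: assoc xy ee xy[THEN mult_eq_extend] ee[THEN mult_eq_extend])
  then have xe: "x \<^bold>* e = e \<^bold>* x" by (simp only: yex)
  have "y \<^bold>* e \<^bold>* x \<^bold>* y = y \<^bold>* e"
    by (simp add: assoc xy ee xy[THEN mult_eq_extend] ee[THEN mult_eq_extend])
  then have ye: "y \<^bold>* e = e \<^bold>* y" by (simp only: yex)
  have eq: "e \<^bold>* (e \<^bold>* x) = e \<^bold>* x" "e \<^bold>* x \<^bold>* e = e \<^bold>* x" "e \<^bold>* (e \<^bold>* y) = e \<^bold>* y" "e \<^bold>* y \<^bold>* e = e \<^bold>* y"
   
      by (simp_all add: assoc xe ye ee xe[THEN mult_eq_extend] ye[THEN mult_eq_extend] ee[THEN mult_eq_extend])
  have inv: "e \<^bold>* x \<^bold>* (e \<^bold>* y) = e" "e \<^bold>* y \<^bold>* (e \<^bold>* x) = e"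
    using 1 2 yex ye by simp_all
  have "e \<^bold>* x \<in> H_class e" "e \<^bold>* y \<in> H_class e"
    unfolding H_class_idempotent_iff[OF e] using eq inv by blast+
  then show "x \<in> H_quotient e" "y \<in> H_quotient e"
    using xe ye by (simp_all add: H_quotient_def)
qed

text \<open>If \<open>x \<^bold>* y\<close> lies in \<open>H_quotient e\<close>, then an inverse of \<open>e \<^bold>* x \<^bold>* y\<close> in the group
  \<open>H_class e\<close> turns \<open>x\<close> into a left factor and \<open>y\<close> into a right factor of \<open>e\<close>.\<close>

lemma viable_imp_E_viable:
  assumes viable
  shows E_viable
  unfolding E_viable_def viable_idempotent_def coideal_def ideal_def
proof (intro ballI conjI allI)
  fix e assume e: "e \<in> idempotents"
  show "e \<in> idempotents" by (fact e)
  have factors: "x \<in> H_quotient e \<and> y \<in> H_quotient e" if "x \<^bold>* y \<in> H_quotient e" for x y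
  proof -
    have comm: "x \<^bold>* y \<^bold>* e = e \<^bold>* (x \<^bold>* y)" and H: "e \<^bold>* (x \<^bold>* y) \<in> H_class e"
      using that by (auto simp: H_quotient_def)
    obtain g where g: "e \<^bold>* (x \<^bold>* y) \<^bold>* g = e" "g \<^bold>* (e \<^bold>* (x \<^bold>* y)) = e"
      using H unfolding H_class_idempotent_iff[OF e] by blast
    have "x \<^bold>* (y \<^bold>* e \<^bold>* g) = x \<^bold>* y \<^bold>* e \<^bold>* g"
      by (simp add: assoc)
    also have "\<dots> = e" by (simp only: comm g(1))
    finally have "x \<^bold>* (y \<^bold>* e \<^bold>* g) = e" .
    moreover have "g \<^bold>* e \<^bold>* x \<^bold>* y = e" using g(2) by (simp add: assoc)
    ultimately show ?thesis
      using viable_factors_in_H_quotient[OF assms e] by blast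
  qed
  fix i x assume "i \<in> - H_quotient e"
  then show "i \<^bold>* x \<in> - H_quotient e" "x \<^bold>* i \<in> - H_quotient e"
    unfolding Compl_iff using factors by blast+
qed

lemma idempotent_in_H_quotient:
  assumes "e \<in> idempotents"
  shows "e \<in> H_quotient e"
  using assms self_in_H_class by (simp add: H_quotient_def idempotents_def)

text \<open>
  If neither indicator function separates the idempotents \<open>x\<close> and \<open>y\<close>, then \<open>x \<^bold>* y = y \<^bold>* x\<close> is an
  idempotent in both of the groups \<open>H_class x\<close> and \<open>H_class y\<close>, hence equal to both of their units.
\<close>

lemma E_viable_imp_E_separated:
  assumes E_viable
  shows E_separated
proof (rule E_separatedI)
  fix x y assume x: "x \<in> idempotents" and y: "y \<in> idempotents" and "x \<noteq> y"
  have hom: "semigroup_hom (\<^bold>*) (\<and>) (\<lambda>z. z \<in> H_quotient e)" if "e \<in> idempotents" for e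
    using assms that mult_in_H_quotient_iff unfolding E_viable_def semigroup_hom_def by blast
  have "y \<notin> H_quotient x \<or> x \<notin> H_quotient y"
  proof (rule ccontr)
    assume "\<not> ?thesis"
    then have comm: "y \<^bold>* x = x \<^bold>* y" and Hx: "x \<^bold>* y \<in> H_class x" and Hy: "x \<^bold>* y \<in> H_class y"
      by (auto simp: H_quotient_def)
    have "x \<^bold>* y \<in> idempotents"
      using x y by (simp add: idempotents_def assoc comm
        mult_eq_extend[OF comm] mult_eq_extend[of x x x] mult_eq_extend[of y y y])
    then have "x \<^bold>* y = x" "x \<^bold>* y = y"
      using idempotent_in_H_class_unique x y Hx Hy by blast+
    then show False using \<open>x \<noteq> y\<close> by simp
  qed
  then obtain e where "e \<in> idempotents" "(x \<in> H_quotient e) \<noteq> (y \<in> H_quotient e)"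
    using x y idempotent_in_H_quotient by blast
  moreover have "semilattice (\<and>)" by standard auto
  ultimately show "\<exists>(g :: bool \<Rightarrow> bool \<Rightarrow> bool) h. semilattice g \<and> semigroup_hom (\<^bold>*) g h \<and> h x \<noteq> h y"
    using hom by blast
qed

lemma E_separated_imp_viable:
  assumes E_separated
  shows viable
  unfolding viable_def
proof (intro allI impI, rule ccontr)
  fix x y assume "{x \<^bold>* y, y \<^bold>* x} \<subseteq> idempotents" "x \<^bold>* y \<noteq> y \<^bold>* x"
  then have "\<exists>(g :: 'a set \<Rightarrow> 'a set \<Rightarrow> 'a set) h.
      semilattice g \<and> semigroup_hom (\<^bold>*) g h \<and> h (x \<^bold>* y) \<noteq> h (y \<^bold>* x)"
    using assms by (simp add: E_separated_def)
  then obtain g :: "'a set \<Rightarrow> 'a set \<Rightarrow> 'a set" and h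
    where g: "semilattice g" and h: "semigroup_hom (\<^bold>*) g h" "h (x \<^bold>* y) \<noteq> h (y \<^bold>* x)"
    by (elim exE conjE)
  interpret Y: semilattice g by (fact g)
  show False using h by (simp add: semigroup_hom_def Y.commute)
qed

lemma E_viable_imp_E_Up_central:
  assumes E_viable
  shows E_Up_central
  unfolding E_Up_central_def
proof (intro ballI)
  fix e x assume e: "e \<in> idempotents" and x: "x \<in> Up e"
  define \<chi> :: "'a \<Rightarrow> nat" where "\<chi> z = (if z \<in> H_quotient e then 1 else 0)" for z
  have "viable_idempotent e" using assms e by (simp add: E_viable_def)
  then have "character \<chi>"
    by (auto simp: character_def semigroup_hom_def \<chi>_def mult_in_H_quotient_iff)
  then have "\<chi> e \<le> \<chi> x" using x by (simp add: Up_def lesssim_def)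
  then have "x \<in> H_quotient e"
    using idempotent_in_H_quotient[OF e] by (auto simp: \<chi>_def split: if_splits)
  then show "e \<^bold>* x = x \<^bold>* e" by (simp add: H_quotient_def)
qed

lemma factors_in_Up: "x \<in> Up (x \<^bold>* y)" "y \<in> Up (x \<^bold>* y)"
proof -
  have "\<chi> (x \<^bold>* y) \<le> \<chi> x \<and> \<chi> (x \<^bold>* y) \<le> \<chi> y" if "character \<chi>" for \<chi>
  proof -
    have "\<chi> x \<in> {0, 1}" "\<chi> y \<in> {0, 1}" "\<chi> (x \<^bold>* y) = \<chi> x * \<chi> y"
      using that by (auto simp: character_def semigroup_hom_def)
    then show ?thesis by auto
  qed
  then show "x \<in> Up (x \<^bold>* y)" "y \<in> Up (x \<^bold>* y)"
    by (simp_all add: Up_def lesssim_def)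
qed

lemma E_Up_central_imp_E_hypercentral:
  assumes E_Up_central
  shows E_hypercentral
  unfolding E_hypercentral_def
proof (intro ballI allI impI)
  fix e x y assume "e \<in> idempotents" and "x \<^bold>* y = e"
  moreover have "x \<in> Up e" "y \<in> Up e"
    using factors_in_Up(1)[of x y] factors_in_Up(2)[of y x] \<open>x \<^bold>* y = e\<close> by simp_all
  ultimately show "x \<^bold>* e = e \<^bold>* x \<and> y \<^bold>* e = e \<^bold>* y"
    using assms unfolding E_Up_central_def by metis
qed

text \<open>
  For \<open>e = x \<^bold>* y\<close> and \<open>f = y \<^bold>* x\<close> one has \<open>e = e \<^bold>* e = x \<^bold>* f \<^bold>* y\<close> and \<open>f = f \<^bold>* f = y \<^bold>* e \<^bold>* x\<close>.
  Moving the middle idempotents outwards gives \<open>e = e \<^bold>* f\<close> and \<open>f = e \<^bold>* f\<close>.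
\<close>

lemma E_hypercentral_imp_viable:
  assumes E_hypercentral
  shows viable
  unfolding viable_def
proof (intro allI impI)
  fix x y assume "{x \<^bold>* y, y \<^bold>* x} \<subseteq> idempotents"
  then have e: "x \<^bold>* y \<in> idempotents" and f: "y \<^bold>* x \<in> idempotents" by auto
  have yf: "y \<^bold>* (y \<^bold>* x) = y \<^bold>* x \<^bold>* y" and ye: "y \<^bold>* (x \<^bold>* y) = x \<^bold>* y \<^bold>* y"
    using assms e f unfolding E_hypercentral_def by blast+
  have "x \<^bold>* y = x \<^bold>* (y \<^bold>* x \<^bold>* y)" using e
    by (simp add: idempotents_def assoc)
  also have "\<dots> = x \<^bold>* y \<^bold>* (y \<^bold>* x)"
    by (simp only: yf[symmetric] assoc[of x y])
  also have "\<dots> = x \<^bold>* y \<^bold>* y \<^bold>* x" by (simp only: assoc)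
  also have "\<dots> = y \<^bold>* (x \<^bold>* y) \<^bold>* x" by (simp only: ye)
  also have "\<dots> = y \<^bold>* x" using f by (simp add: idempotents_def assoc)
  finally show "x \<^bold>* y = y \<^bold>* x" .
qed

lemma E_hypercentral_imp_E_hypocentral:
  assumes E_hypercentral
  shows E_hypocentral
  using assms unfolding E_hypercentral_def E_hypocentral_def by blast

lemma pow_left_factor: "\<exists>z. pow x n \<^bold>* y = x \<^bold>* z"
  by (cases "n - 1") (auto simp: pow_def assoc)

text \<open>Some power of \<open>x\<close>, and hence \<open>x\<close> itself, is a left factor of \<open>d\<close>, and therefore of
  \<open>e = d \<^bold>* e\<close>.\<close>

lemma E_hypercentral_imp_E_upcentral:
  assumes E_hypercentral
  shows E_upcentral
  unfolding E_upcentral_def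
proof (intro ballI impI)
  fix e d x
  assume e: "e \<in> idempotents" and d: "d \<in> idempotents" and le: "d \<^bold>* e = e \<and> e = e \<^bold>* d"
    and "x \<in> root_infinity (H_class d)"
  then obtain n where "pow x n \<in> H_class d" by (auto simp: root_infinity_def)
  then obtain y where "pow x n \<^bold>* y = d"
    unfolding H_class_idempotent_iff[OF d] by blast
  then have "pow x n \<^bold>* (y \<^bold>* e) = e" using le by (simp add: assoc[symmetric])
  then obtain z where "x \<^bold>* z = e" using pow_left_factor[of x n "y \<^bold>* e"] by auto
  then show "x \<^bold>* e = e \<^bold>* x" using assms e unfolding E_hypercentral_def by blast
qed

end

theorem theorem3p2:
  fixes mult :: "'a \<Rightarrow> 'a \<Rightarrow> 'a"
  assumes "semigroup mult"
  shows "(semigroup.E_separated mult \<longleftrightarrow> semigroup.E_viable mult) \<and>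
    (semigroup.E_viable mult \<longleftrightarrow> semigroup.E_Up_central mult) \<and>
    (semigroup.E_Up_central mult \<longleftrightarrow> semigroup.E_hypercentral mult) \<and>
    (semigroup.E_hypercentral mult \<longleftrightarrow> semigroup.viable mult) \<and>
    (semigroup.E_separated mult \<longrightarrow>
      semigroup.E_hypocentral mult \<and> semigroup.E_upcentral mult)"
proof -
  interpret semigroup mult by (fact assms)
  show ?thesis
    using E_separated_imp_viable viable_imp_E_viable E_viable_imp_E_separated
      E_viable_imp_E_Up_central E_Up_central_imp_E_hypercentral E_hypercentral_imp_viable
      E_hypercentral_imp_E_hypocentral E_hypercentral_imp_E_upcentral
    by blast
qed

end
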